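(* Let $S=\{132,213\}$. For $n\ge1$ and $0\le c<n$, $$f_S(n,c,x)=\sum_{i=1}^{n}x^{\triangle_i}f_S(n-i,c+i,x),\qquad \triangle_i=\begin{cases}n-c,&i>n-c,\\0,&i\le n-c.\end{cases}$$ Also, for $c\ge0$, $f_S(0,c,x)=f_S(1,c,x)=1$, and $f_S(n,c,x)=|\operatorname{Av}_n(132,213)|=2^{n-1}$ for $1\le n\le c$; and $f_S(n,c,1)=2^{n-1}$ for $n\ge1$. Moreover, writing $f_S(n,x)=f_S(n,0,x)$, for $n\ge1$, $$f_S(n+4,x)=(x+1)f_S(n+3,x)-(x-4)f_S(n+2,x)-4(x+1)f_S(n+1,x)+4x\,f_S(n,x),$$ where $f_S(0,x)=1$, $f_S(1,x)=1$, $f_S(2,x)=2$, $f_S(3,x)=x+3$ and $f_S(4,x)=x^2+7$.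
   Context: $\mathfrak S_n$ is the set of permutations of $\{1,\dots,n\}$. $\operatorname{Av}_n(S)$ is the set of $\pi\in\mathfrak S_n$ having no subsequence order-isomorphic to any element of $S$. For $\pi\in\mathfrak S_n$ and $c\in\mathbb Z$, the number of shifted double deficiencies of $\pi$ with shift $c$ is $$\operatorname{DD}_c(\pi)=\#\{j\in\{1,\ldots,n\}: 1\le j+c\le n,\ \pi(j)<j+c<\pi^{-1}(j+c)+c\}.$$ For $c=0$ this is the number $\operatorname{DD}(\pi)$ of double deficiencies, i.e. of indices $k$ with $\pi(k)<k<\pi^{-1}(k)$. For $n,c\ge0$, $f_S(n,c,x)=\sum_{\pi\in\operatorname{Av}_n(S)}x^{\operatorname{DD}_c(\pi)}$. *)

theory Defs
  imports
    "HOL-Combinatorics.Permutations"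
    "HOL-Computational_Algebra.Polynomial"
    "HOL-Library.Sublist"
begin

definition one_line :: "nat \<Rightarrow> (nat \<Rightarrow> nat) \<Rightarrow> nat list" where
  "one_line n \<pi> = map \<pi> [1..<Suc n]"

definition order_isomorphic :: "nat list \<Rightarrow> nat list \<Rightarrow> bool" where
  "order_isomorphic xs ys \<longleftrightarrow>
     length xs = length ys \<and>
     (\<forall>i<length xs. \<forall>j<length xs. xs ! i < xs ! j \<longleftrightarrow> ys ! i < ys ! j)"

text \<open>Permutations of \<open>{1..n}\<close> are functions (the identity elsewhere);
  patterns are given in one-line notation, e.g. \<open>[1, 3, 2]\<close> for 132.
  \<open>subseq\<close> is the library's not necessarily contiguous subsequence relation.\<close>

definition Av :: "nat \<Rightarrow> nat list set \<Rightarrow> (nat \<Rightarrow> nat) set" where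
  "Av n S = {\<pi>. \<pi> permutes {1..n} \<and>
     \<not> (\<exists>\<sigma>\<in>S. \<exists>xs. subseq xs (one_line n \<pi>) \<and> order_isomorphic xs \<sigma>)}"

definition DD :: "nat \<Rightarrow> int \<Rightarrow> (nat \<Rightarrow> nat) \<Rightarrow> nat" where
  "DD n c \<pi> = card {j \<in> {1..n}.
     1 \<le> int j + c \<and> int j + c \<le> int n \<and>
     int (\<pi> j) < int j + c \<and> int j + c < int (inv \<pi> (nat (int j + c))) + c}"

abbreviation X :: "int poly" where
  "X \<equiv> [:0, 1:]"

definition f :: "nat list set \<Rightarrow> nat \<Rightarrow> nat \<Rightarrow> int poly" where
  "f S n c = (\<Sum>\<pi>\<in>Av n S. X ^ DD n (int c) \<pi>)"

definition triangle :: "nat \<Rightarrow> nat \<Rightarrow> nat \<Rightarrow> nat" where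
  "triangle n c i = (if i > n - c then n - c else 0)"

end

theory Submission
  imports Defs
begin

text \<open>
  A permutation avoids 132 and 213 exactly when its one-line notation is a skew sum of increasing
  runs: the first run consists of the \<open>i\<close> largest values in increasing order, and the remaining
  entries form an arbitrary avoider \<open>\<tau>\<close> of size \<open>n - i\<close> (\<open>bij_betw_skew\<close>). Indeed, if \<open>\<pi> j\<close> is at
  least \<open>\<pi> 1\<close>, the value \<open>\<pi> j + 1\<close> has to stand right after \<open>\<pi> j\<close>, because anything else creates a
  forbidden pattern with position \<open>1\<close> or with position \<open>j + 1\<close> (\<open>avoider_successor\<close>).

  The statistic is compatible with this decomposition. If \<open>i \<le> n - c\<close>, no position of the
  first run is counted, and moving past the run turns the shift \<open>c\<close> into \<open>c + i\<close>. If
  \<open>i > n - c\<close>, the first run covers all \<open>n - c\<close> positions that can be counted, and it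
  counts all of them. Summing over \<open>(i, \<tau>)\<close> gives the recursion for \<open>f S n c\<close>, and with weight
  \<open>1\<close> it gives the cardinality \<open>2 ^ (n - 1)\<close>.

  For the linear recurrence, subtract the recursion for \<open>(n - 1, c + 1)\<close> from the one for
  \<open>(n, c)\<close>: both have the same inner terms, since the recursion keeps \<open>n + c\<close> fixed. What is left
  is a first-order recursion along each antidiagonal (\<open>F_antidiagonal\<close>), whose solution for
  positive shifts is a power of two times a sequence \<open>h d\<close> in \<open>d = n - c\<close> alone
  (\<open>F_positive_shift\<close>, with \<open>h = diag X\<close>). It satisfies
  \<open>h (d + 2) = 4 h d + x ^ (d + 2) - 2 x ^ d + 1\<close>, so \<open>h\<close>, and with it
  \<open>f S (d + 2) 0 = 2 h d - x ^ d + 1\<close>, obeys the linear recurrence with characteristic polynomial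
  \<open>(t\<^sup>2 - 4) (t - x) (t - 1)\<close>, which is the stated one.
\<close>

section \<open>Pattern avoidance in terms of positions\<close>

lemma subseq_triple_map_iff:
  "subseq [x, y, z] (map p [l..<m]) \<longleftrightarrow>
     (\<exists>a b c. l \<le> a \<and> a < b \<and> b < c \<and> c < m \<and> x = p a \<and> y = p b \<and> z = p c)"
proof -
  have head: "subseq (v # vs) (map p [k..<m]) \<longleftrightarrow>
      (\<exists>a. k \<le> a \<and> a < m \<and> v = p a \<and> subseq vs (map p [Suc a..<m]))" for v vs k
  proof (induction "m - k" arbitrary: k)
    case 0
    then show ?case by auto
  next
    case (Suc d)
    then have k: "k < m" and IH: "subseq (v # vs) (map p [Suc k..<m]) \<longleftrightarrow>
      (\<exists>a. Suc k \<le> a \<and> a < m \<and> v = p a \<and> subseq vs (map p [Suc a..<m]))"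
      using Suc(1)[of "Suc k"] by auto
    have upt: "[k..<m] = k # [Suc k..<m]" using k by (rule upt_conv_Cons)
    show ?case
    proof (cases "v = p k")
      case True
      have "subseq vs (map p [Suc k..<m])" if "subseq vs (map p [Suc a..<m])" "k \<le> a" "a < m" for a
      proof -
        have "[Suc k..<m] = [Suc k..<Suc a] @ [Suc a..<m]"
          using upt_add_eq_append[of "Suc k" "Suc a" "m - Suc a"] that by simp
        then show ?thesis using that(1) by (metis map_append list_emb_append2)
      qed
      then show ?thesis using True k unfolding upt by auto
    next
      case False
      then have "subseq (v # vs) (map p [k..<m]) \<longleftrightarrow> subseq (v # vs) (map p [Suc k..<m])"
        unfolding upt by simp
      then show ?thesis unfolding IH using False
        by (metis Suc_leD le_antisym not_less_eq_eq)
    qed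
  qed
  show ?thesis unfolding head by (fastforce simp: Suc_le_eq)
qed

lemma order_isomorphic_132: "order_isomorphic xs [1, 3, 2] \<longleftrightarrow>
    (\<exists>x y z. xs = [x, y, z] \<and> x < z \<and> z < y)"
proof -
  have "order_isomorphic xs [1, 3, 2] \<Longrightarrow> \<exists>x y z. xs = [x, y, z]"
    by (auto simp: order_isomorphic_def length_Suc_conv numeral_eq_Suc)
  moreover have "order_isomorphic [x, y, z] [1, 3, 2] \<longleftrightarrow> x < z \<and> z < y" for x y z
    by (auto simp: order_isomorphic_def less_Suc_eq numeral_eq_Suc)
  ultimately show ?thesis by blast
qed

lemma order_isomorphic_213: "order_isomorphic xs [2, 1, 3] \<longleftrightarrow>
    (\<exists>x y z. xs = [x, y, z] \<and> y < x \<and> x < z)"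
proof -
  have "order_isomorphic xs [2, 1, 3] \<Longrightarrow> \<exists>x y z. xs = [x, y, z]"
    by (auto simp: order_isomorphic_def length_Suc_conv numeral_eq_Suc)
  moreover have "order_isomorphic [x, y, z] [2, 1, 3] \<longleftrightarrow> y < x \<and> x < z" for x y z
    by (auto simp: order_isomorphic_def less_Suc_eq numeral_eq_Suc)
  ultimately show ?thesis by blast
qed

definition avoiders :: "nat \<Rightarrow> (nat \<Rightarrow> nat) set" where
  "avoiders n = Av n {[1, 3, 2], [2, 1, 3]}"

lemma avoiders_iff:
  "\<pi> \<in> avoiders n \<longleftrightarrow> \<pi> permutes {1..n} \<and>
     (\<forall>a b c. 1 \<le> a \<and> a < b \<and> b < c \<and> c \<le> n \<longrightarrow>
        \<not> (\<pi> a < \<pi> c \<and> \<pi> c < \<pi> b) \<and> \<not> (\<pi> b < \<pi> a \<and> \<pi> a < \<pi> c))"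
proof -
  have "(\<exists>\<sigma>\<in>{[1, 3, 2], [2, 1, 3]}. \<exists>xs. subseq xs (one_line n \<pi>) \<and> order_isomorphic xs \<sigma>)
      \<longleftrightarrow> (\<exists>x y z. subseq [x, y, z] (one_line n \<pi>) \<and> (x < z \<and> z < y \<or> y < x \<and> x < z))"
    unfolding bex_simps order_isomorphic_132 order_isomorphic_213 by blast
  also have "\<dots> \<longleftrightarrow> (\<exists>a b c. 1 \<le> a \<and> a < b \<and> b < c \<and> c \<le> n \<and>
      (\<pi> a < \<pi> c \<and> \<pi> c < \<pi> b \<or> \<pi> b < \<pi> a \<and> \<pi> a < \<pi> c))"
    unfolding one_line_def subseq_triple_map_iff less_Suc_eq_le by blast
  finally show ?thesis unfolding avoiders_def Av_def by blast
qed

lemma finite_avoiders: "finite (avoiders n)"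
  by (rule finite_subset[OF _ finite_permutations[of "{1..n}"]]) (auto simp: avoiders_iff)

lemma avoiders_0: "avoiders 0 = {id}"
  by (auto simp: avoiders_iff)

section \<open>The skew sum decomposition\<close>

text \<open>The permutation that starts with the run \<open>n - i + 1, \<dots>, n\<close> and continues with the
  entries of \<open>\<tau>\<close>; it is the identity outside \<open>{1..n}\<close>, as \<open>permutes\<close> demands.\<close>

definition skew :: "nat \<Rightarrow> nat \<Rightarrow> (nat \<Rightarrow> nat) \<Rightarrow> nat \<Rightarrow> nat" where
  "skew n i \<tau> j =
     (if j \<in> {1..i} then n - i + j else if j \<in> {i<..n} then \<tau> (j - i) else j)"

lemma permutes_if_inj_endo:
  assumes "finite A" "inj_on p A" "p ` A \<subseteq> A" "\<And>x. x \<notin> A \<Longrightarrow> p x = x"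
  shows "p permutes A"
  using assms by (intro bij_imp_permutes) (auto simp: bij_betw_def endo_inj_surj)

lemma permutes_range:
  assumes "\<tau> permutes {1..m}" "k \<in> {1..m}"
  shows "1 \<le> \<tau> k" "\<tau> k \<le> m"
  using permutes_in_image[OF assms(1)] assms(2) by auto

lemma skew_permutes:
  assumes i: "i \<le> n" and t: "\<tau> permutes {1..n - i}"
  shows "skew n i \<tau> permutes {1..n}"
proof (rule permutes_if_inj_endo)
  have r: "1 \<le> \<tau> (j - i) \<and> \<tau> (j - i) \<le> n - i" if "i < j" "j \<le> n" for j
    using permutes_range[OF t, of "j - i"] that diff_le_mono[of j n i] by auto
  show "skew n i \<tau> ` {1..n} \<subseteq> {1..n}"
  proof clarify
    fix j assume "j \<in> {1..n}"
    then show "skew n i \<tau> j \<in> {1..n}" using r[of j] i by (auto simp: skew_def)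
  qed
  show "inj_on (skew n i \<tau>) {1..n}"
  proof (rule inj_onI)
    fix a b assume ab: "a \<in> {1..n}" "b \<in> {1..n}" "skew n i \<tau> a = skew n i \<tau> b"
    have inj: "\<tau> (a - i) = \<tau> (b - i) \<Longrightarrow> a - i = b - i"
      using permutes_inj[OF t] by (auto dest: injD)
    show "a = b"
      using ab r[of a] r[of b] inj by (auto simp: skew_def split: if_splits)
  qed
qed (use i in \<open>auto simp: skew_def\<close>)

lemma skew_in_avoiders:
  assumes i: "i \<le> n" and t: "\<tau> \<in> avoiders (n - i)"
  shows "skew n i \<tau> \<in> avoiders n"
  unfolding avoiders_iff
proof (intro conjI allI impI)
  have tp: "\<tau> permutes {1..n - i}"
    and av: "\<And>a b c. 1 \<le> a \<Longrightarrow> a < b \<Longrightarrow> b < c \<Longrightarrow> c \<le> n - i \<Longrightarrow>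
        \<not> (\<tau> a < \<tau> c \<and> \<tau> c < \<tau> b) \<and> \<not> (\<tau> b < \<tau> a \<and> \<tau> a < \<tau> c)"
    using t unfolding avoiders_iff by auto
  show "skew n i \<tau> permutes {1..n}" using skew_permutes[OF i tp] .
  fix a b c assume abc: "1 \<le> a \<and> a < b \<and> b < c \<and> c \<le> n"
  have r: "\<tau> (j - i) \<le> n - i" if "i < j" "j \<le> n" for j
    using permutes_range[OF tp, of "j - i"] that diff_le_mono[of j n i] by auto
  have low: "skew n i \<tau> j = n - i + j" if "1 \<le> j" "j \<le> i" for j
    using that by (auto simp: skew_def)
  have high: "skew n i \<tau> j = \<tau> (j - i)" "skew n i \<tau> j \<le> n - i" if "i < j" "j \<le> n" for j
    using that r[of j] by (auto simp: skew_def)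
  consider "c \<le> i" | "b \<le> i" "i < c" | "a \<le> i" "i < b" | "i < a" by linarith
  then have "\<not> (skew n i \<tau> a < skew n i \<tau> c \<and> skew n i \<tau> c < skew n i \<tau> b)
      \<and> \<not> (skew n i \<tau> b < skew n i \<tau> a \<and> skew n i \<tau> a < skew n i \<tau> c)"
  proof cases
    case 1
    then show ?thesis using abc low[of a] low[of b] low[of c] by auto
  next
    case 2
    then show ?thesis using abc low[of a] low[of b] high[of c] by auto
  next
    case 3
    then show ?thesis using abc low[of a] high[of b] high[of c] by auto
  next
    case 4
    then have "1 \<le> a - i" "a - i < b - i" "b - i < c - i" "c - i \<le> n - i"
      using abc by (auto intro: diff_le_mono)
    then show ?thesis using 4 abc high(1)[of a] high(1)[of b] high(1)[of c]
      av[of "a - i" "b - i" "c - i"] by auto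
  qed
  then show "\<not> (skew n i \<tau> a < skew n i \<tau> c \<and> skew n i \<tau> c < skew n i \<tau> b)"
    "\<not> (skew n i \<tau> b < skew n i \<tau> a \<and> skew n i \<tau> a < skew n i \<tau> c)" by auto
qed

text \<open>Let \<open>k\<close> be the position of the value \<open>\<pi> j + 1\<close>. If \<open>k < j\<close>, then positions \<open>1, k, j\<close> form
  a 132. If \<open>k > j + 1\<close>, then \<open>j, j + 1, k\<close> form a 132 or a 213, according to whether
  \<open>\<pi> (j + 1)\<close> is above or below \<open>\<pi> j\<close>.\<close>

lemma avoider_successor:
  assumes p: "\<pi> \<in> avoiders n" and j: "1 \<le> j" "j \<le> n" and ge: "\<pi> 1 \<le> \<pi> j" and lt: "\<pi> j < n"
  shows "\<pi> (Suc j) = Suc (\<pi> j)" "Suc j \<le> n"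
proof -
  have perm: "\<pi> permutes {1..n}"
    and av: "\<And>a b c. 1 \<le> a \<Longrightarrow> a < b \<Longrightarrow> b < c \<Longrightarrow> c \<le> n \<Longrightarrow>
        \<not> (\<pi> a < \<pi> c \<and> \<pi> c < \<pi> b) \<and> \<not> (\<pi> b < \<pi> a \<and> \<pi> a < \<pi> c)"
    using p unfolding avoiders_iff by auto
  have inj: "\<And>a b. \<pi> a = \<pi> b \<Longrightarrow> a = b" using permutes_inj[OF perm] by (auto dest: injD)
  have "Suc (\<pi> j) \<in> \<pi> ` {1..n}" using lt permutes_image[OF perm] by auto
  then obtain k where k: "1 \<le> k" "k \<le> n" "\<pi> k = Suc (\<pi> j)" by auto
  have "j < k"
  proof (rule ccontr)
    assume "\<not> j < k"
    moreover have "k \<noteq> j" using k by auto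
    moreover have "k \<noteq> 1" using k ge by auto
    ultimately have "1 < k" "k < j" using k by auto
    moreover have "\<pi> 1 \<noteq> \<pi> j" using inj[of 1 j] \<open>1 < k\<close> \<open>k < j\<close> by auto
    ultimately show False using av[of 1 k j] ge k j by auto
  qed
  have "k = Suc j"
  proof (rule ccontr)
    assume "k \<noteq> Suc j"
    then have "Suc j < k" using \<open>j < k\<close> by auto
    moreover have "\<pi> (Suc j) \<noteq> \<pi> j" "\<pi> (Suc j) \<noteq> \<pi> k"
      using inj[of "Suc j" j] inj[of "Suc j" k] \<open>Suc j < k\<close> by auto
    ultimately show False using av[of j "Suc j" k] j k by linarith
  qed
  then show "\<pi> (Suc j) = Suc (\<pi> j)" "Suc j \<le> n" using k by auto
qed

lemma avoider_first_run:
  assumes p: "\<pi> \<in> avoiders n" and n: "1 \<le> n" and m: "\<pi> 1 + m \<le> n"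
  shows "\<pi> (Suc m) = \<pi> 1 + m \<and> Suc m \<le> n"
  using m
proof (induction m)
  case 0
  then show ?case using n by simp
next
  case (Suc m)
  then show ?case using avoider_successor[OF p, of "Suc m"] by auto
qed

text \<open>The first run takes up all values from \<open>\<pi> 1\<close> to \<open>n\<close>, so injectivity leaves exactly
  \<open>{1..n - i}\<close> for the positions behind it.\<close>

lemma avoider_is_skew:
  assumes p: "\<pi> \<in> avoiders n" and n: "1 \<le> n"
  obtains i \<tau> where "i \<in> {1..n}" "\<tau> \<in> avoiders (n - i)" "\<pi> = skew n i \<tau>"
proof -
  have perm: "\<pi> permutes {1..n}"
    and av: "\<And>a b c. 1 \<le> a \<Longrightarrow> a < b \<Longrightarrow> b < c \<Longrightarrow> c \<le> n \<Longrightarrow>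
        \<not> (\<pi> a < \<pi> c \<and> \<pi> c < \<pi> b) \<and> \<not> (\<pi> b < \<pi> a \<and> \<pi> a < \<pi> c)"
    using p unfolding avoiders_iff by auto
  have inj: "\<And>a b. \<pi> a = \<pi> b \<Longrightarrow> a = b" using permutes_inj[OF perm] by (auto dest: injD)
  define i where "i = Suc n - \<pi> 1"
  define \<tau> where "\<tau> k = (if k \<in> {1..n - i} then \<pi> (k + i) else k)" for k
  have p1: "1 \<le> \<pi> 1" "\<pi> 1 \<le> n" using permutes_range[OF perm, of 1] n by auto
  then have i: "1 \<le> i" "i \<le> n" "\<pi> 1 = Suc n - i" unfolding i_def by auto
  have run: "\<pi> j = n - i + j" if "1 \<le> j" "j \<le> i" for j
    using avoider_first_run[OF p n, of "j - 1"] that i p1 by auto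
  have small: "1 \<le> \<pi> j \<and> \<pi> j \<le> n - i" if "i < j" "j \<le> n" for j
  proof (rule ccontr)
    assume neg: "\<not> (1 \<le> \<pi> j \<and> \<pi> j \<le> n - i)"
    have "1 \<le> \<pi> j" "\<pi> j \<le> n" using permutes_range[OF perm, of j] that by auto
    then have "\<pi> (\<pi> j - (n - i)) = \<pi> j" using run[of "\<pi> j - (n - i)"] neg i by auto
    then show False using inj[of "\<pi> j - (n - i)" j] \<open>\<pi> j \<le> n\<close> that i by auto
  qed
  have "\<tau> permutes {1..n - i}"
  proof (rule permutes_if_inj_endo)
    show "inj_on \<tau> {1..n - i}" by (rule inj_onI) (auto simp: \<tau>_def dest: inj)
    show "\<tau> ` {1..n - i} \<subseteq> {1..n - i}"
    proof clarify
      fix k assume "k \<in> {1..n - i}"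
      then show "\<tau> k \<in> {1..n - i}" using small[of "k + i"] by (auto simp: \<tau>_def)
    qed
  qed (auto simp: \<tau>_def)
  moreover have "\<not> (\<tau> a < \<tau> c \<and> \<tau> c < \<tau> b) \<and> \<not> (\<tau> b < \<tau> a \<and> \<tau> a < \<tau> c)"
    if "1 \<le> a \<and> a < b \<and> b < c \<and> c \<le> n - i" for a b c
    using that av[of "a + i" "b + i" "c + i"] le_diff_conv2[OF i(2), of c]
    by (auto simp: \<tau>_def)
  ultimately have "\<tau> \<in> avoiders (n - i)" unfolding avoiders_iff by blast
  moreover have "\<pi> = skew n i \<tau>"
  proof
    fix j
    have "j \<notin> {1..n} \<Longrightarrow> \<pi> j = j" using perm by (auto simp: permutes_def)
    then show "\<pi> j = skew n i \<tau> j" using run[of j] i by (auto simp: skew_def \<tau>_def)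
  qed
  ultimately show thesis using that i by auto
qed

lemma bij_betw_skew:
  assumes n: "1 \<le> n"
  shows "bij_betw (\<lambda>(i, \<tau>). skew n i \<tau>) (SIGMA i:{1..n}. avoiders (n - i)) (avoiders n)"
proof -
  have "i = i' \<and> \<tau> = \<tau>'"
    if i: "i \<in> {1..n}" "i' \<in> {1..n}" and t: "\<tau> \<in> avoiders (n - i)" "\<tau>' \<in> avoiders (n - i')"
      and eq: "skew n i \<tau> = skew n i' \<tau>'" for i i' \<tau> \<tau>'
  proof -
    have "n - i + 1 = n - i' + 1" using fun_cong[OF eq, of 1] i by (auto simp: skew_def)
    then have ii: "i' = i" using i by auto
    have "\<tau> k = \<tau>' k" for k
    proof (cases "k \<in> {1..n - i}")
      case True
      then have "k + i \<le> n" using i by auto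
      then show ?thesis using True fun_cong[OF eq, of "k + i"] i ii by (auto simp: skew_def)
    next
      case False
      then show ?thesis using t ii by (auto simp: avoiders_iff permutes_def)
    qed
    then show ?thesis using ii by auto
  qed
  then have "inj_on (\<lambda>(i, \<tau>). skew n i \<tau>) (SIGMA i:{1..n}. avoiders (n - i))"
    by (intro inj_onI) auto
  moreover have "(\<lambda>(i, \<tau>). skew n i \<tau>) ` (SIGMA i:{1..n}. avoiders (n - i)) = avoiders n"
  proof
    show "(\<lambda>(i, \<tau>). skew n i \<tau>) ` (SIGMA i:{1..n}. avoiders (n - i)) \<subseteq> avoiders n"
      using skew_in_avoiders by auto
    show "avoiders n \<subseteq> (\<lambda>(i, \<tau>). skew n i \<tau>) ` (SIGMA i:{1..n}. avoiders (n - i))"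
    proof
      fix \<pi> assume "\<pi> \<in> avoiders n"
      then obtain i \<tau> where "i \<in> {1..n}" "\<tau> \<in> avoiders (n - i)" "\<pi> = skew n i \<tau>"
        using avoider_is_skew n by blast
      then show "\<pi> \<in> (\<lambda>(i, \<tau>). skew n i \<tau>) ` (SIGMA i:{1..n}. avoiders (n - i))"
        by (intro image_eqI[of _ _ "(i, \<tau>)"]) auto
    qed
  qed
  ultimately show ?thesis by (simp add: bij_betw_def)
qed

lemma sum_avoiders:
  fixes g :: "(nat \<Rightarrow> nat) \<Rightarrow> 'b :: comm_monoid_add"
  assumes "1 \<le> n"
  shows "sum g (avoiders n) = (\<Sum>i = 1..n. \<Sum>\<tau>\<in>avoiders (n - i). g (skew n i \<tau>))"
proof -
  have "sum g (avoiders n)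
      = (\<Sum>(i, \<tau>)\<in>(SIGMA i:{1..n}. avoiders (n - i)). g (skew n i \<tau>))"
    using sum.reindex_bij_betw[OF bij_betw_skew[OF assms], of g] by (simp add: case_prod_beta)
  also have "\<dots> = (\<Sum>i = 1..n. \<Sum>\<tau>\<in>avoiders (n - i). g (skew n i \<tau>))"
    by (rule sum.Sigma[symmetric]) (auto simp: finite_avoiders)
  finally show ?thesis .
qed

lemma card_avoiders_rec:
  assumes "1 \<le> n"
  shows "card (avoiders n) = (\<Sum>m<n. card (avoiders m))"
proof -
  have "card (avoiders n) = (\<Sum>i = 1..n. card (avoiders (n - i)))"
    using sum_avoiders[OF assms, of "\<lambda>_. 1 :: nat"] by simp
  also have "\<dots> = (\<Sum>m<n. card (avoiders m))"
    by (rule sum.reindex_bij_witness[of _ "\<lambda>m. n - m" "\<lambda>i. n - i"]) auto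
  finally show ?thesis .
qed

lemma card_avoiders_Suc: "card (avoiders (Suc m)) = 2 ^ m"
proof (induction m)
  case 0
  then show ?case using card_avoiders_rec[of 1] by (simp add: avoiders_0)
next
  case (Suc m)
  then show ?case using card_avoiders_rec[of "Suc (Suc m)"] card_avoiders_rec[of "Suc m"] by simp
qed

section \<open>The statistic on a skew sum\<close>

lemma DD_nat: "DD n (int c) \<pi> =
    card {j \<in> {1..n}. j + c \<le> n \<and> \<pi> j < j + c \<and> j < inv \<pi> (j + c)}"
proof -
  have "nat (int j + int c) = j + c" for j by simp
  then show ?thesis unfolding DD_def by (intro arg_cong[where f = card]) auto
qed

lemma DD_eq_0: "n \<le> c \<Longrightarrow> DD n (int c) \<pi> = 0"
  by (auto simp: DD_nat)

text \<open>A position can only be counted if \<open>j \<le> n - c < i\<close>, so it lies in the first run, where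
  \<open>\<pi> j = j + (n - i) < j + c\<close>. The value \<open>j + c\<close> lies in the run as well, at the later
  position \<open>j + (c - (n - i))\<close>.\<close>

lemma DD_skew_long_run:
  assumes i: "i \<le> n" "n - c < i" and c: "c < n" and t: "\<tau> permutes {1..n - i}"
  shows "DD n (int c) (skew n i \<tau>) = n - c"
proof -
  have "j \<in> {1..n} \<and> j + c \<le> n \<and> skew n i \<tau> j < j + c \<and> j < inv (skew n i \<tau>) (j + c)
      \<longleftrightarrow> j \<in> {1..n - c}" for j
  proof -
    have "inv (skew n i \<tau>) (j + c) = j + c - (n - i)" if "j \<in> {1..n - c}"
      using that i c permutes_inv_eq[OF skew_permutes[OF i(1) t]] by (auto simp: skew_def)
    then show ?thesis using i c by (auto simp: skew_def)
  qed
  then have "DD n (int c) (skew n i \<tau>) = card {1..n - c}"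
    unfolding DD_nat by (intro arg_cong[where f = card]) blast
  then show ?thesis by simp
qed

text \<open>In the first run \<open>\<pi> j = j + (n - i) \<ge> j + c\<close>, so nothing is counted there. A position
  \<open>k + i\<close> behind the run is compared with the value \<open>k + (c + i)\<close> of \<open>\<tau>\<close>, whence the new shift;
  if that value exceeds \<open>n - i\<close>, it stands in the run, too far left to be counted.\<close>

lemma DD_skew_short_run:
  assumes i: "i \<le> n" "i \<le> n - c" and c: "c < n" and t: "\<tau> permutes {1..n - i}"
  shows "DD n (int c) (skew n i \<tau>) = DD (n - i) (int (c + i)) \<tau>"
proof -
  note inv_iff = permutes_inv_eq[OF skew_permutes[OF i(1) t]]
  let ?B = "{k \<in> {1..n - i}. k + (c + i) \<le> n - i \<and> \<tau> k < k + (c + i) \<and> k < inv \<tau> (k + (c + i))}"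
  have inv_low: "inv (skew n i \<tau>) v = inv \<tau> v + i" if v: "1 \<le> v" "v \<le> n - i" for v
  proof -
    have "inv \<tau> v \<in> {1..n - i}" "\<tau> (inv \<tau> v) = v"
      using permutes_in_image[OF permutes_inv[OF t], of v] permutes_inverses[OF t] v by auto
    then show ?thesis unfolding inv_iff by (auto simp: skew_def)
  qed
  have inv_high: "inv (skew n i \<tau>) v = v - (n - i)" if v: "n - i < v" "v \<le> n" for v
    using v i unfolding inv_iff by (auto simp: skew_def)
  have "{j \<in> {1..n}. j + c \<le> n \<and> skew n i \<tau> j < j + c \<and> j < inv (skew n i \<tau>) (j + c)}
      = (\<lambda>k. k + i) ` ?B" (is "?A = _")
  proof (intro equalityI subsetI)
    fix j assume j: "j \<in> ?A"
    have ij: "i < j"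
      using j i c by (auto simp: skew_def split: if_splits)
    have "j + c \<le> n - i"
    proof (rule ccontr)
      assume "\<not> j + c \<le> n - i"
      then have "inv (skew n i \<tau>) (j + c) = j + c - (n - i)" using inv_high j by auto
      then show False using j i c by auto
    qed
    then have "j - i \<in> ?B" using j ij inv_low[of "j + c"] by (auto simp: skew_def)
    then show "j \<in> (\<lambda>k. k + i) ` ?B" using ij by (intro image_eqI[of _ _ "j - i"]) auto
  next
    fix j assume "j \<in> (\<lambda>k. k + i) ` ?B"
    then obtain k where k: "k \<in> ?B" "j = k + i" by auto
    then show "j \<in> ?A" using inv_low[of "k + (c + i)"] by (auto simp: skew_def ac_simps)
  qed
  then show ?thesis unfolding DD_nat by (simp add: card_image)
qed

section \<open>Recursions for the generating polynomials\<close>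

definition F :: "nat \<Rightarrow> nat \<Rightarrow> int poly" where
  "F = f {[1, 3, 2], [2, 1, 3]}"

lemma F_eq_sum: "F n c = (\<Sum>\<pi>\<in>avoiders n. X ^ DD n (int c) \<pi>)"
  by (simp only: F_def f_def avoiders_def)

lemma F_rec:
  assumes "c < n"
  shows "F n c = (\<Sum>i = 1..n. X ^ triangle n c i * F (n - i) (c + i))"
proof -
  have "X ^ DD n (int c) (skew n i \<tau>)
      = X ^ triangle n c i * X ^ DD (n - i) (int (c + i)) \<tau>"
    if i: "i \<in> {1..n}" and t: "\<tau> \<in> avoiders (n - i)" for i \<tau>
  proof (cases "i \<le> n - c")
    case True
    then show ?thesis using DD_skew_short_run[of i n c \<tau>] assms i t
      by (simp add: triangle_def avoiders_iff)
  next
    case False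
    then show ?thesis using DD_skew_long_run[of i n c \<tau>] DD_eq_0[of "n - i" "c + i" \<tau>] assms i t
      by (simp add: triangle_def avoiders_iff)
  qed
  then show ?thesis unfolding F_eq_sum
    using assms by (subst sum_avoiders) (auto simp: sum_distrib_left intro!: sum.cong)
qed

lemma F_eq_card: "n \<le> c \<Longrightarrow> F n c = of_nat (card (avoiders n))"
  by (simp add: F_eq_sum DD_eq_0)

lemma poly_F_1: "poly (F n c) 1 = int (card (avoiders n))"
  by (simp add: F_eq_sum poly_sum)

lemma F_0: "F 0 c = 1"
  by (simp add: F_eq_card avoiders_0)

text \<open>The terms with \<open>i > n - c\<close> are constants times \<open>X ^ (n - c)\<close>; by
  \<open>card_avoiders_rec\<close> the constants add up to the number of avoiders whose size is the
  shift. The shift is written \<open>Suc c\<close> because shift \<open>0\<close> has no such terms (\<open>F_split_0\<close>). Since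
  \<open>F_antidiagonal\<close> is needed from \<open>d = 0\<close> on, the constant case \<open>d = 0\<close> is covered too.\<close>

lemma F_split_positive:
  "F (Suc c + d) (Suc c) = (\<Sum>i = 1..d. F (Suc c + d - i) (Suc c + i)) + 2 ^ c * X ^ d"
proof (cases "d = 0")
  case True
  then show ?thesis by (simp add: F_eq_card card_avoiders_Suc)
next
  case False
  let ?n = "Suc c + d"
  let ?t = "\<lambda>i. X ^ triangle ?n (Suc c) i * F (?n - i) (Suc c + i)"
  have "F ?n (Suc c) = (\<Sum>i = 1..?n. ?t i)"
    using False by (intro F_rec) auto
  also have "\<dots> = (\<Sum>i = 1..d. ?t i) + (\<Sum>i = Suc d..?n. ?t i)"
    by (subst sum.union_disjoint[symmetric]) (auto simp del: sum.cl_ivl_Suc intro!: sum.cong)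
  also have "(\<Sum>i = 1..d. ?t i) = (\<Sum>i = 1..d. F (?n - i) (Suc c + i))"
    by (intro sum.cong) (auto simp: triangle_def)
  also have "(\<Sum>i = Suc d..?n. ?t i) = (\<Sum>m<Suc c. X ^ d * of_nat (card (avoiders m)))"
    by (rule sum.reindex_bij_witness[of _ "\<lambda>m. ?n - m" "\<lambda>i. ?n - i"])
      (auto simp: triangle_def F_eq_card)
  also have "\<dots> = X ^ d * of_nat (card (avoiders (Suc c)))"
    by (subst card_avoiders_rec) (auto simp: sum_distrib_left distrib_left)
  finally show ?thesis by (simp add: card_avoiders_Suc mult.commute)
qed

lemma F_split_0:
  assumes "1 \<le> d"
  shows "F d 0 = (\<Sum>i = 1..d. F (d - i) i)"
  using assms by (subst F_rec) (auto simp: triangle_def intro!: sum.cong)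

lemma sum_peel_ends:
  fixes g :: "nat \<Rightarrow> 'a :: comm_monoid_add"
  shows "(\<Sum>i = 1..d + 2. g i) = g 1 + (\<Sum>i = 1..d. g (Suc i)) + g (d + 2)"
proof -
  have "(\<Sum>i = 1..d + 2. g i) = (\<Sum>i = 1..Suc d. g i) + g (d + 2)" by simp
  also have "(\<Sum>i = 1..Suc d. g i) = g 1 + (\<Sum>i = Suc 1..Suc d. g i)"
    by (rule sum.atLeast_Suc_atMost) simp
  finally show ?thesis unfolding sum.shift_bounds_cl_Suc_ivl .
qed

text \<open>The term \<open>i = 1\<close> is the next entry of the antidiagonal. The terms with \<open>2 \<le> i \<le> d + 1\<close> are
  the recursion sum of that same entry, without its summand \<open>2 ^ c * X ^ d\<close>. The last term has a
  shift at least its size, so it is a constant.\<close>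

lemma F_antidiagonal:
  "(\<Sum>i = 1..d + 2. F (c + d + 2 - i) (c + i))
     = 2 * F (Suc c + d) (Suc c) - 2 ^ c * X ^ d + of_nat (card (avoiders c))"
proof -
  have "(\<Sum>i = 1..d. F (c + d + 2 - Suc i) (c + Suc i))
      = F (Suc c + d) (Suc c) - 2 ^ c * X ^ d"
    by (subst F_split_positive) (auto intro!: sum.cong)
  then show ?thesis
    unfolding sum_peel_ends by (simp add: F_eq_card algebra_simps)
qed

section \<open>The linear recurrence\<close>

text \<open>The entries of the table of \<open>F\<close> at \<open>n - c = d\<close>, \<open>c \<ge> 1\<close>, up to the factor
  \<open>2 ^ (c - 1)\<close>.\<close>

fun diag :: "'a :: comm_ring_1 \<Rightarrow> nat \<Rightarrow> 'a" where
  "diag x 0 = 1"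
| "diag x (Suc 0) = x + 1"
| "diag x (Suc (Suc d)) = 4 * diag x d + x ^ (d + 2) - 2 * x ^ d + 1"

lemma F_positive_shift: "F (Suc c + d) (Suc c) = 2 ^ c * diag X d"
proof (induction d arbitrary: c rule: induct_nat_012)
  case 0
  then show ?case by (simp add: F_eq_card card_avoiders_Suc)
next
  case 1
  \<comment> \<open>Naming \<open>X\<close> prevents computation with its coefficient list.\<close>
  define x where "x = X"
  have "F (Suc c + 1) (Suc c) = 2 ^ c + 2 ^ c * x"
    unfolding F_split_positive x_def[symmetric] by (simp add: F_eq_card card_avoiders_Suc)
  then show ?case by (simp add: distrib_left x_def[symmetric])
next
  case (ge2 d)
  define x where "x = X"
  have "F (Suc c + (d + 2)) (Suc c)
      = 2 * F (Suc (Suc c) + d) (Suc (Suc c)) - 2 ^ Suc c * x ^ d + 2 ^ c + 2 ^ c * x ^ (d + 2)"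
    using F_split_positive[of c "d + 2"] F_antidiagonal[where c = "Suc c" and d = d]
    by (simp add: card_avoiders_Suc x_def)
  also have "\<dots> = 2 ^ c * diag x (Suc (Suc d))"
    unfolding ge2(1)[of "Suc c"] x_def[symmetric] by (simp add: algebra_simps)
  finally show ?case by (simp add: x_def)
qed

lemma F_shift_0: "F (d + 2) 0 = 2 * diag X d - X ^ d + 1"
  using F_split_0[of "d + 2"] F_antidiagonal[where c = 0 and d = d] F_positive_shift[of 0 d]
  by (simp add: avoiders_0)

lemma diag_recurrence:
  fixes x :: "'a :: comm_ring_1"
  defines "g \<equiv> \<lambda>d. 2 * diag x d - x ^ d + 1"
  shows "g (d + 4) =
    (x + 1) * g (d + 3) - (x - 4) * g (d + 2) - 4 * (x + 1) * g (d + 1) + 4 * x * g d"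
  unfolding g_def by (simp add: eval_nat_numeral algebra_simps)

lemma F_1: "F 1 c = 1"
  using F_split_0[of 1] by (cases c) (simp_all add: F_0 F_eq_card card_avoiders_Suc[of 0, simplified])

text \<open>For \<open>n \<ge> 2\<close> every value that occurs is given by \<open>F_shift_0\<close>. That formula does not reach
  \<open>F 1 0 = 1\<close>, so the case \<open>n = 1\<close> is a computation.\<close>

lemma F_recurrence:
  assumes "1 \<le> n"
  shows "F (n + 4) 0 =
    (X + 1) * F (n + 3) 0 - (X - 4) * F (n + 2) 0 - 4 * (X + 1) * F (n + 1) 0 + 4 * X * F n 0"
proof (cases "n = 1")
  case True
  define x where "x = X"
  have shift: "F (d + 2) 0 = 2 * diag x d - x ^ d + 1" for d
    using F_shift_0 unfolding x_def .
  have "F 1 0 = 1" by (rule F_1)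
  then show ?thesis
    using True shift[of 3] shift[of 2] shift[of 1] shift[of 0] unfolding x_def[symmetric]
    by (simp add: eval_nat_numeral algebra_simps)
next
  case False
  then obtain d where n: "n = d + 2" using assms
    using that[of "n - 2"] by simp
  have n_add: "n + k = d + k + 2" for k using n by simp
  have n_0: "F n 0 = 2 * diag X d - X ^ d + 1" using F_shift_0[of d] n by simp
  show ?thesis unfolding n_add F_shift_0 n_0 by (rule diag_recurrence)
qed

theorem mainTheorem12:
  fixes S :: "nat list set"
  assumes S: "S = {[1, 3, 2], [2, 1, 3]}"
  shows "(\<forall>n c. n \<ge> 1 \<and> c < n \<longrightarrow>
            f S n c = (\<Sum>i = 1..n. X ^ triangle n c i * f S (n - i) (c + i)))
       \<and> (\<forall>c. f S 0 c = 1 \<and> f S 1 c = 1)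
       \<and> (\<forall>n c. 1 \<le> n \<and> n \<le> c \<longrightarrow>
            f S n c = of_nat (card (Av n S)) \<and> card (Av n S) = 2 ^ (n - 1))
       \<and> (\<forall>n c. n \<ge> 1 \<longrightarrow> poly (f S n c) 1 = 2 ^ (n - 1))
       \<and> (\<forall>n\<ge>1. f S (n + 4) 0 =
            (X + 1) * f S (n + 3) 0 - (X - 4) * f S (n + 2) 0
            - 4 * (X + 1) * f S (n + 1) 0 + 4 * X * f S n 0)
       \<and> f S 0 0 = 1 \<and> f S 1 0 = 1 \<and> f S 2 0 = 2
       \<and> f S 3 0 = X + 3 \<and> f S 4 0 = X ^ 2 + 7"
proof -
  have card: "card (avoiders n) = 2 ^ (n - 1)" if "1 \<le> n" for n
    using card_avoiders_Suc[of "n - 1"] that by simp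
  define x where "x = X"
  have shift: "F (d + 2) 0 = 2 * diag x d - x ^ d + 1" for d
    using F_shift_0 unfolding x_def .
  have "F 2 0 = 2" "F 3 0 = x + 3" "F 4 0 = x ^ 2 + 7"
    using shift[of 0] shift[of 1] shift[of 2] by (simp_all add: eval_nat_numeral algebra_simps)
  then show ?thesis
    unfolding S x_def F_def[symmetric] avoiders_def[symmetric] using F_rec F_0 F_1 F_eq_card card poly_F_1 F_recurrence
    by (intro conjI allI impI) auto
qed

end
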